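(* Let $\Omega(S,n)$ be a sample space with a finite support set $S\subset\mathbb{R}$ of at least $2$ elements, and let the sample size $n$ be at least $2$. Then for any confidence level $1-\alpha$ with $0<1-\alpha<1$ there exists no optimal lower bound for $\Omega(S,n)$; that is, there is no valid lower bound on $\Omega(S,n)$ that dominates every other valid lower bound on $\Omega(S,n)$.
   Context: For a finite set $S\subset\mathbb{R}$ and an integer $n\ge1$, the sample space is $\Omega=\Omega(S,n)=\{(x_1,\dots,x_n)\in S^n: x_1\le\dots\le x_n\}$. $\mathcal{F}=\mathcal{F}(S)$ is the closed simplex of all probability distributions on $S$ (zero masses allowed), and $\mu(F)=\sum_{s\in S}sF(s)$. For $x\in\Omega$ containing $\hat x_s$ copies of $s$, $\Pr_F(x)=\frac{n!}{\prod_{s}\hat x_s!}\prod_{s\in S}F(s)^{\hat x_s}$ (with $0^0=1$), and $\Pr_F(A)=\sum_{x\in A}\Pr_F(x)$ for $A\subseteq\Omega$. A lower bound is any map $B:\Omega\to[-\infty,\infty]$. It is valid (at confidence level $1-\alpha$) if $\Pr_F(\{x\in\Omega: B(x)>\mu(F)\})\le\alpha$ for every $F\in\mathcal{F}$. For valid bounds, $B_1$ dominates $B_2$ if $B_1(x)\ge B_2(x)$ for all $x\in\Omega$ with strict inequality for at least one $x$. A bound is optimal if it is valid and dominates every other valid bound. *)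

theory Defs
  imports "HOL-Probability.Probability_Mass_Function" "HOL-Library.FuncSet"
begin

text \<open>An ordered sample \<open>x\<^sub>1 \<le> \<dots> \<le> x\<^sub>n\<close> is a sorted list;
  the number of copies of \<open>s\<close> in \<open>x\<close> is \<^term>\<open>count_list x s\<close>.\<close>

definition sample_space :: "real set \<Rightarrow> nat \<Rightarrow> real list set" where
  "sample_space S n = {x. length x = n \<and> set x \<subseteq> S \<and> sorted x}"

text \<open>Only the inclusion of the support in \<open>S\<close> is required: zero masses on \<open>S\<close> are allowed.\<close>

definition distributions :: "real set \<Rightarrow> real pmf set" where
  "distributions S = {F. set_pmf F \<subseteq> S}"

definition mean :: "real set \<Rightarrow> real pmf \<Rightarrow> real" where
  "mean S F = (\<Sum>s\<in>S. s * pmf F s)"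

definition sample_prob :: "real set \<Rightarrow> nat \<Rightarrow> real pmf \<Rightarrow> real list \<Rightarrow> real" where
  "sample_prob S n F x =
     fact n / (\<Prod>s\<in>S. fact (count_list x s)) * (\<Prod>s\<in>S. pmf F s ^ count_list x s)"

definition event_prob :: "real set \<Rightarrow> nat \<Rightarrow> real pmf \<Rightarrow> real list set \<Rightarrow> real" where
  "event_prob S n F A = (\<Sum>x\<in>A. sample_prob S n F x)"

text \<open>Bounds are extensional functions, so that two bounds are equal iff they agree on the
  sample space, as for maps with domain \<open>\<Omega>\<close>.\<close>

definition lower_bounds :: "real set \<Rightarrow> nat \<Rightarrow> (real list \<Rightarrow> ereal) set" where
  "lower_bounds S n = sample_space S n \<rightarrow>\<^sub>E UNIV"

definition valid_bound :: "real set \<Rightarrow> nat \<Rightarrow> real \<Rightarrow> (real list \<Rightarrow> ereal) \<Rightarrow> bool" where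
  "valid_bound S n \<alpha> B \<longleftrightarrow> B \<in> lower_bounds S n \<and>
     (\<forall>F\<in>distributions S.
        event_prob S n F {x \<in> sample_space S n. B x > ereal (mean S F)} \<le> \<alpha>)"

definition dominates ::
    "real set \<Rightarrow> nat \<Rightarrow> (real list \<Rightarrow> ereal) \<Rightarrow> (real list \<Rightarrow> ereal) \<Rightarrow> bool" where
  "dominates S n B\<^sub>1 B\<^sub>2 \<longleftrightarrow>
     (\<forall>x\<in>sample_space S n. B\<^sub>1 x \<ge> B\<^sub>2 x) \<and> (\<exists>x\<in>sample_space S n. B\<^sub>1 x > B\<^sub>2 x)"

definition optimal_bound :: "real set \<Rightarrow> nat \<Rightarrow> real \<Rightarrow> (real list \<Rightarrow> ereal) \<Rightarrow> bool" where
  "optimal_bound S n \<alpha> B \<longleftrightarrow> valid_bound S n \<alpha> B \<and>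
     (\<forall>B'. valid_bound S n \<alpha> B' \<and> B' \<noteq> B \<longrightarrow> dominates S n B B')"

end

theory Submission
  imports Defs
begin

text \<open>
  An optimal bound is pointwise at least as large as every valid bound
  (\<open>optimal_bound_ge_valid_bound\<close>), and this is already impossible on two samples.  Let \<open>a = min S\<close>, let \<open>b \<in> S\<close> be a larger point, and consider the samples with
  \<open>n\<close> and with \<open>n - 1\<close> copies of \<open>b\<close>, the other entry being \<open>a\<close>.  If \<open>b\<close> has mass \<open>t\<close>, these have
  probability \<open>t ^ n\<close> and at most \<open>n * t ^ (n - 1) * (1 - t)\<close>.  Let \<open>m\<close> be the first \<open>t\<close> at which
  one of these two functions reaches \<open>\<alpha>\<close> (\<open>critical_mass_exists\<close>).

  Since \<open>a\<close> is the least point of \<open>S\<close>, every distribution with mean below \<open>a + (b - a) * m\<close> gives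
  \<open>b\<close> mass less than \<open>m\<close> (\<open>mean_ge_min_plus_mass\<close>), so each of the two samples has probability at
  most \<open>\<alpha>\<close>.  Hence, by \<open>valid_single_sample_bound\<close>, the
  bound that claims \<open>a + (b - a) * m\<close> on one of them and \<open>-\<infinity>\<close> on all other samples is valid.  An
  optimal bound has to be at least \<open>a + (b - a) * m\<close> on both of them simultaneously.

  At \<open>t = m\<close>, however, one of the two functions is \<open>\<alpha>\<close> and the other is positive, so that their
  sum exceeds \<open>\<alpha>\<close>; by continuity it still does for some \<open>t < m\<close>.  Under the distribution with
  masses \<open>1 - t\<close> and \<open>t\<close> on \<open>a\<close> and \<open>b\<close> that sum is exactly the probability of the two samples,
  which refutes validity.
\<close>

section \<open>Probabilities and means on two support points\<close>

lemma finite_sample_space: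
  assumes "finite S"
  shows "finite (sample_space S n)"
  unfolding sample_space_def
  by (rule finite_subset[OF _ finite_lists_length_eq[OF assms, of n]]) auto

lemma sample_prob_nonneg: "0 \<le> sample_prob S n F x"
  unfolding sample_prob_def by (intro mult_nonneg_nonneg divide_nonneg_nonneg prod_nonneg) auto

lemma sample_prob_two_values:
  assumes "finite S" and "a \<in> S" and "b \<in> S" and "a \<noteq> b" and "k \<le> n"
  shows "sample_prob S n F (replicate (n - k) a @ replicate k b) =
           real (n choose k) * pmf F a ^ (n - k) * pmf F b ^ k"
proof -
  let ?x = "replicate (n - k) a @ replicate k b"
  have cnt: "count_list ?x s = (if s = a then n - k else if s = b then k else 0)" for s
  proof -
    have "count_list (replicate j c) s = (if s = c then j else 0)" for j and c :: real
      by (induction j) auto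
    then show ?thesis
      using \<open>a \<noteq> b\<close> by auto
  qed
  \<comment> \<open>Used with the factorials and with the powers of the masses: points of \<open>S\<close> that do not
    occur in the sample contribute the factor \<open>1\<close>.\<close>
  have prod: "(\<Prod>s\<in>S. g s (count_list ?x s)) = g a (n - k) * g b k"
    if "\<And>s. g s 0 = 1" for g :: "real \<Rightarrow> nat \<Rightarrow> real"
  proof -
    have "(\<Prod>s\<in>S. g s (count_list ?x s)) = (\<Prod>s\<in>{a, b}. g s (count_list ?x s))"
      by (rule prod.mono_neutral_right) (use assms that cnt in auto)
    then show ?thesis
      using \<open>a \<noteq> b\<close> by (simp add: cnt del: count_list_append)
  qed
  have "real (n choose k) = fact n / (fact (n - k) * fact k)"
    using binomial_fact[OF \<open>k \<le> n\<close>, where 'a = real] by (simp add: mult.commute)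
  then show ?thesis
    unfolding sample_prob_def
    using prod[of "\<lambda>s j. fact j"] prod[of "\<lambda>s j. pmf F s ^ j"] by simp
qed

text \<open>
  Moving all mass outside \<open>b\<close> down to the least point \<open>a\<close> can only lower the mean.  This is what
  reduces validity over all of \<open>S\<close> to a condition on the single number \<open>pmf F b\<close>.
\<close>

lemma mean_ge_min_plus_mass:
  assumes "finite S" and "F \<in> distributions S" and "b \<in> S" and "\<And>s. s \<in> S \<Longrightarrow> a \<le> s"
  shows "a + (b - a) * pmf F b \<le> mean S F"
proof -
  have total: "(\<Sum>s\<in>S. pmf F s) = 1"
    using assms by (intro sum_pmf_eq_1) (auto simp: distributions_def)
  have "(b - a) * pmf F b \<le> (\<Sum>s\<in>S. (s - a) * pmf F s)"
    using assms by (intro member_le_sum) auto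
  also have "\<dots> = mean S F - a * (\<Sum>s\<in>S. pmf F s)"
    by (simp add: mean_def sum_subtractf sum_distrib_left algebra_simps)
  finally show ?thesis
    by (simp add: total)
qed

lemma two_point_distribution:
  assumes "finite S" and "a \<in> S" and "b \<in> S" and "a \<noteq> b" and "0 \<le> t" and "t \<le> 1"
  obtains F where "F \<in> distributions S" and "pmf F a = 1 - t" and "pmf F b = t"
    and "mean S F = a + (b - a) * t"
proof -
  define f where "f = (\<lambda>c. if c then b else a)"
  define F where "F = map_pmf f (bernoulli_pmf t)"
  have "inj f"
    using \<open>a \<noteq> b\<close> by (auto simp: f_def inj_on_def)
  then have "pmf F (f c) = pmf (bernoulli_pmf t) c" for c
    by (simp add: F_def pmf_map_inj')
  from this[of False] this[of True] have mass: "pmf F a = 1 - t" "pmf F b = t"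
    using assms by (simp_all add: f_def)
  have supp: "set_pmf F \<subseteq> {a, b}"
    by (auto simp: F_def f_def)
  have "mean S F = (\<Sum>s\<in>{a, b}. s * pmf F s)"
    unfolding mean_def
    by (rule sum.mono_neutral_right) (use assms supp in \<open>auto simp: set_pmf_iff\<close>)
  then have "mean S F = a + (b - a) * t"
    using \<open>a \<noteq> b\<close> mass by (simp add: algebra_simps)
  then show ?thesis
    using that[of F] mass supp assms by (auto simp: distributions_def)
qed

section \<open>Bounds that are informative on a single sample\<close>

definition single_sample_bound :: "real set \<Rightarrow> nat \<Rightarrow> real list \<Rightarrow> real \<Rightarrow> real list \<Rightarrow> ereal" where
  "single_sample_bound S n y c =
     (\<lambda>x\<in>sample_space S n. if x = y then ereal c else - \<infinity>)"

lemma valid_single_sample_bound: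
  assumes "y \<in> sample_space S n" and "0 \<le> \<alpha>"
    and "\<And>F. F \<in> distributions S \<Longrightarrow> mean S F < c \<Longrightarrow> sample_prob S n F y \<le> \<alpha>"
  shows "valid_bound S n \<alpha> (single_sample_bound S n y c)"
  unfolding valid_bound_def
proof (intro conjI ballI)
  show "single_sample_bound S n y c \<in> lower_bounds S n"
    by (auto simp: single_sample_bound_def lower_bounds_def)
next
  fix F assume "F \<in> distributions S"
  have "{x \<in> sample_space S n. single_sample_bound S n y c x > ereal (mean S F)} =
          (if mean S F < c then {y} else {})"
    using assms(1) by (auto simp: single_sample_bound_def)
  then show "event_prob S n F
      {x \<in> sample_space S n. single_sample_bound S n y c x > ereal (mean S F)} \<le> \<alpha>"
    using assms \<open>F \<in> distributions S\<close> by (auto simp: event_prob_def)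
qed

lemma optimal_bound_ge_valid_bound:
  assumes "optimal_bound S n \<alpha> B" and "valid_bound S n \<alpha> B'" and "x \<in> sample_space S n"
  shows "B' x \<le> B x"
  using assms by (cases "B' = B") (auto simp: optimal_bound_def dominates_def)

section \<open>The critical mass\<close>

text \<open>
  The minimum \<open>m\<close> of the closed set where one of the two functions is at least \<open>\<alpha>\<close> exists
  because \<open>1 ^ n > \<alpha>\<close>.  It is positive because both functions vanish at \<open>0\<close>, which for
  \<open>n * t ^ (n - 1) * (1 - t)\<close> requires \<open>n \<ge> 2\<close>.  At \<open>m\<close> the sum of the two functions is strictly
  above \<open>\<alpha>\<close>, so some \<open>p\<close> strictly to the left of \<open>m\<close> inherits this.
\<close>

lemma critical_mass_exists:
  fixes \<alpha> :: real and n :: nat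
  assumes "n \<ge> 2" and "0 < \<alpha>" and "\<alpha> < 1"
  obtains p m where "0 \<le> p" and "p < m" and "m \<le> 1"
    and "\<forall>t\<in>{0..<m}. t ^ n \<le> \<alpha>"
    and "\<forall>t\<in>{0..<m}. real n * t ^ (n - 1) * (1 - t) \<le> \<alpha>"
    and "\<alpha> < p ^ n + real n * p ^ (n - 1) * (1 - p)"
proof -
  define g where "g = (\<lambda>t::real. max (t ^ n) (real n * t ^ (n - 1) * (1 - t)))"
  define h where "h = (\<lambda>t::real. t ^ n + real n * t ^ (n - 1) * (1 - t))"
  define K where "K = {t \<in> {0..1}. \<alpha> \<le> g t}"
  have "continuous_on UNIV g"
    unfolding g_def by (intro continuous_intros)
  then have "closed {t. \<alpha> \<le> g t}"
    by (intro closed_Collect_le continuous_intros)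
  then have "compact ({0..1} \<inter> {t. \<alpha> \<le> g t})"
    by (intro compact_Int_closed compact_Icc)
  then have "compact K"
    by (simp add: K_def Int_def)
  moreover have "1 \<in> K"
    using assms by (simp add: K_def g_def)
  then have "K \<noteq> {}"
    by blast
  ultimately obtain m where "m \<in> K" and least: "\<And>t. t \<in> K \<Longrightarrow> m \<le> t"
    using compact_attains_inf[of K] by blast
  have m: "0 \<le> m" "m \<le> 1" "\<alpha> \<le> g m"
    using \<open>m \<in> K\<close> by (auto simp: K_def)
  have below: "g t < \<alpha>" if "0 \<le> t" "t < m" for t
    using least[of t] that m by (force simp: K_def)
  have "g 0 = 0"
    using assms by (simp add: g_def power_0_left)
  with m \<open>0 < \<alpha>\<close> have "0 < m"
    by (cases "m = 0") auto
  have "\<alpha> < h m"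
  proof (cases "m = 1")
    case True
    then show ?thesis using assms by (simp add: h_def)
  next
    case False
    then have "0 < m ^ n" "0 < real n * m ^ (n - 1) * (1 - m)"
      using assms m \<open>0 < m\<close> by auto
    then show ?thesis
      using m(3) unfolding g_def h_def by linarith
  qed
  moreover have "continuous_on UNIV h"
    unfolding h_def by (intro continuous_intros)
  then have "(h \<longlongrightarrow> h m) (at_left m)"
    by (meson continuous_on_def UNIV_I tendsto_within_subset subset_UNIV)
  ultimately have "\<forall>\<^sub>F t in at_left m. \<alpha> < h t"
    by (simp add: order_tendstoD)
  moreover have "\<forall>\<^sub>F t in at_left m. t \<in> {0<..<m}"
    using \<open>0 < m\<close> by (rule eventually_at_left_real)
  ultimately have "\<forall>\<^sub>F t in at_left m. \<alpha> < h t \<and> t \<in> {0<..<m}"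
    by (rule eventually_conj)
  then obtain p where "\<alpha> < h p" "0 < p" "p < m"
    using eventually_happens'[OF trivial_limit_at_left_real] by fastforce
  then show ?thesis
    using that[of p m] m(2) below unfolding g_def h_def by fastforce
qed

section \<open>Non-existence of an optimal bound\<close>

theorem theorem4p2:
  fixes S :: "real set" and n :: nat and \<alpha> :: real
  assumes "finite S" and "card S \<ge> 2" and "n \<ge> 2"
    and "0 < 1 - \<alpha>" and "1 - \<alpha> < 1"
  shows "\<not> (\<exists>B. optimal_bound S n \<alpha> B)"
proof
  assume "\<exists>B. optimal_bound S n \<alpha> B"
  then obtain B where B: "optimal_bound S n \<alpha> B" ..
  define a where "a = Min S"
  define b where "b = Max S"
  have "S \<noteq> {}" and "\<not> (\<exists>s. S = {s})"
    using assms by auto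
  then have ab: "a \<in> S" "b \<in> S" and a_le: "\<And>s. s \<in> S \<Longrightarrow> a \<le> s" and "a \<noteq> b"
    using assms(1) Min_le[of S] Max_ge[of S] unfolding a_def b_def
    by (auto, metis antisym is_singletonI' is_singleton_def)
  then have "a < b"
    using a_le[OF \<open>b \<in> S\<close>] by linarith
  have "0 < \<alpha>" "\<alpha> < 1"
    using assms(4,5) by simp_all
  then obtain p m where mp: "0 \<le> p" "p < m" "m \<le> 1"
    and pow_n: "\<forall>t\<in>{0..<m}. t ^ n \<le> \<alpha>"
    and pow_n1: "\<forall>t\<in>{0..<m}. real n * t ^ (n - 1) * (1 - t) \<le> \<alpha>"
    and exceeds: "\<alpha> < p ^ n + real n * p ^ (n - 1) * (1 - p)"
    by (rule critical_mass_exists[OF assms(3)])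
  define c where "c = a + (b - a) * m"
  define x where "x = (\<lambda>k. replicate (n - k) a @ replicate k b)"
  have x_in: "x k \<in> sample_space S n" if "k \<le> n" for k
    using that ab \<open>a < b\<close> by (auto simp: x_def sample_space_def sorted_append)
  have prob: "sample_prob S n F (x k) = real (n choose k) * pmf F a ^ (n - k) * pmf F b ^ k"
    if "k \<le> n" for F k
    unfolding x_def using sample_prob_two_values assms(1) ab \<open>a \<noteq> b\<close> that by blast
  have prob_n: "sample_prob S n F (x n) = pmf F b ^ n" for F
    by (simp add: prob)
  have prob_n1: "sample_prob S n F (x (n - 1)) = real n * pmf F b ^ (n - 1) * pmf F a" for F
    using assms(3) prob[of "n - 1" F] binomial_symmetric[of 1 n] by simp

  have small: "sample_prob S n F (x n) \<le> \<alpha>" "sample_prob S n F (x (n - 1)) \<le> \<alpha>"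
    if F: "F \<in> distributions S" and "mean S F < c" for F
  proof -
    have "(b - a) * pmf F b < (b - a) * m"
      using mean_ge_min_plus_mass[OF assms(1) F ab(2) a_le] that by (simp add: c_def)
    then have less: "pmf F b < m"
      using \<open>a < b\<close> by simp
    then show "sample_prob S n F (x n) \<le> \<alpha>"
      by (simp add: prob_n pow_n)
    have "sum (pmf F) {a, b} \<le> sum (pmf F) S"
      using assms(1) ab by (intro sum_mono2) auto
    also have "\<dots> = 1"
      using assms(1) F by (intro sum_pmf_eq_1) (auto simp: distributions_def)
    finally have "pmf F a \<le> 1 - pmf F b"
      using \<open>a \<noteq> b\<close> by simp
    then have "real n * pmf F b ^ (n - 1) * pmf F a
        \<le> real n * pmf F b ^ (n - 1) * (1 - pmf F b)"
      by (intro mult_left_mono) auto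
    also have "\<dots> \<le> \<alpha>"
      using less pow_n1[rule_format, of "pmf F b"] by simp
    finally show "sample_prob S n F (x (n - 1)) \<le> \<alpha>"
      by (simp only: prob_n1)
  qed
  have B_ge: "ereal c \<le> B (x k)" if "k \<in> {n - 1, n}" for k
  proof -
    have k: "x k \<in> sample_space S n"
      using that by (intro x_in) auto
    then have "valid_bound S n \<alpha> (single_sample_bound S n (x k) c)"
      using that small assms(4,5) by (intro valid_single_sample_bound) auto
    from optimal_bound_ge_valid_bound[OF B this k] k show ?thesis
      by (simp add: single_sample_bound_def)
  qed

  \<comment> \<open>With mass \<open>p < m\<close> on \<open>b\<close> the mean is below \<open>c\<close>, so \<open>B\<close> errs on both samples.\<close>
  obtain F where F: "F \<in> distributions S" "pmf F a = 1 - p" "pmf F b = p"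
    and mean_F: "mean S F = a + (b - a) * p"
    using two_point_distribution[OF assms(1) ab \<open>a \<noteq> b\<close>, of p] mp by auto
  define A where "A = {y \<in> sample_space S n. B y > ereal (mean S F)}"
  have "mean S F < c"
    using mean_F mp \<open>a < b\<close> by (simp add: c_def)
  then have "ereal (mean S F) < B (x k)" if "k \<in> {n - 1, n}" for k
    using B_ge[OF that] by (metis less_ereal.simps(1) less_le_trans)
  then have "{x n, x (n - 1)} \<subseteq> A"
    using x_in[of n] x_in[of "n - 1"] by (auto simp: A_def)
  moreover have "finite A"
    using finite_sample_space[OF assms(1), of n] by (auto simp: A_def)
  ultimately have "(\<Sum>y\<in>{x n, x (n - 1)}. sample_prob S n F y) \<le> event_prob S n F A"
    unfolding event_prob_def by (intro sum_mono2 sample_prob_nonneg)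
  moreover have "x n \<noteq> x (n - 1)"
  proof -
    have "a \<in> set (x (n - 1))" "a \<notin> set (x n)"
      using assms(3) \<open>a \<noteq> b\<close> by (auto simp: x_def)
    then show ?thesis by metis
  qed
  ultimately have "p ^ n + real n * p ^ (n - 1) * (1 - p) \<le> event_prob S n F A"
    using F by (simp add: prob_n prob_n1 del: One_nat_def)
  moreover have "event_prob S n F A \<le> \<alpha>"
    using B F(1) by (auto simp: optimal_bound_def valid_bound_def A_def)
  ultimately show False
    using exceeds by simp
qed

end
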